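(* Let $A_1,A_2\in\mathbf{C}^{n\times n}$, $F_1,F_2\in\mathbf{C}^{p\times p}$ and $C_1,C_2\in\mathbf{C}^{n\times p}$. The Sylvester bimatrix equation $$\{A_1,A_2\}\{X_1,X_2\}-\{X_1,X_2\}\{F_1,F_2\}=\{C_1,C_2\}$$ in the unknown $\{X_1,X_2\}\in\{\mathbf{C}^{n\times p},\mathbf{C}^{n\times p}\}$ has a unique solution if and only if $$\lambda\{A_1,A_2\}\cap\lambda\{F_1,F_2\}=\varnothing.$$ In this case, the unique solution is given by $$\{X_1,X_2\}=\left(\sum_{k=0}^{2p}\beta_k\{A_1,A_2\}^k\right)^{-1}\sum_{k=1}^{2p}\beta_k\{D_1(k),D_2(k)\},$$ where $\beta(s)=s^{2p}+\beta_{2p-1}s^{2p-1}+\cdots+\beta_1s+\beta_0$ is the characteristic polynomial of $\{F_1,F_2\}$ (with $\beta_{2p}=1$), and, for $k\ge1$, $$\{D_1(k),D_2(k)\}=\sum_{i=0}^{k-1}\{A_1,A_2\}^i\{C_1,C_2\}\{F_1,F_2\}^{k-1-i}.$$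
   Context: $A^{\#}$ denotes the entrywise complex conjugate of $A$. A bimatrix $\{A_1,A_2\}\in\{\mathbf{C}^{n\times m},\mathbf{C}^{n\times m}\}$ is a pair of matrices of the same size, identified with the real-linear map $x\mapsto A_1x+A_2^{\#}x^{\#}$. Addition and multiplication by real scalars are componentwise, and the product corresponds to composition: $\{A_1,A_2\}\{X_1,X_2\}=\{A_1X_1+A_2^{\#}X_2,\;A_1^{\#}X_2+A_2X_1\}$. The identity is $\{I_n,0_{n\times n}\}$ (the zeroth power of a square bimatrix), and inverses are with respect to this product. The eigenvalue set $\lambda\{P_1,P_2\}$ and the characteristic polynomial of a square bimatrix are those of its complex lifting $\{P_1,P_2\}_\diamond=\begin{bmatrix}P_1&P_2^{\#}\\P_2&P_1^{\#}\end{bmatrix}$ (which is similar to a real matrix, so the characteristic polynomial has real coefficients). *)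

theory Defs
  imports "Jordan_Normal_Form.Spectral_Radius" "HOL-Library.Product_Plus"
begin

text \<open>
  A bimatrix is a pair of complex matrices of the same size; the common size is expressed by
  membership in \<open>bimat_carrier n m\<close>. Addition and subtraction are the componentwise operations
  on pairs from \<^theory>\<open>HOL-Library.Product_Plus\<close>.
\<close>

type_synonym bimatrix = "complex mat \<times> complex mat"

definition bimat_carrier :: "nat \<Rightarrow> nat \<Rightarrow> bimatrix set" where
  "bimat_carrier n m = carrier_mat n m \<times> carrier_mat n m"

abbreviation conj_mat :: "complex mat \<Rightarrow> complex mat" where
  "conj_mat A \<equiv> map_mat cnj A"

text \<open>The real-linear map \<open>x \<mapsto> A\<^sub>1 x + A\<^sub>2\<^sup># x\<^sup>#\<close> with which a bimatrix is identified.\<close>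

definition bimat_apply :: "bimatrix \<Rightarrow> complex vec \<Rightarrow> complex vec" where
  "bimat_apply A x = fst A *\<^sub>v x + conj_mat (snd A) *\<^sub>v map_vec cnj x"

definition bimat_mult :: "bimatrix \<Rightarrow> bimatrix \<Rightarrow> bimatrix" (infixl \<open>\<otimes>\<^sub>b\<close> 70) where
  "A \<otimes>\<^sub>b X = (fst A * fst X + conj_mat (snd A) * snd X,
              conj_mat (fst A) * snd X + snd A * fst X)"

definition bimat_smult :: "real \<Rightarrow> bimatrix \<Rightarrow> bimatrix" (infixl \<open>\<cdot>\<^sub>b\<close> 70) where
  "c \<cdot>\<^sub>b A = (complex_of_real c \<cdot>\<^sub>m fst A, complex_of_real c \<cdot>\<^sub>m snd A)"

definition bimat_id :: "nat \<Rightarrow> bimatrix" where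
  "bimat_id n = (1\<^sub>m n, 0\<^sub>m n n)"

primrec bimat_pow :: "bimatrix \<Rightarrow> nat \<Rightarrow> bimatrix" (infixr \<open>^\<^sub>b\<close> 75) where
  "A ^\<^sub>b 0 = bimat_id (dim_row (fst A))"
| "A ^\<^sub>b (Suc k) = A ^\<^sub>b k \<otimes>\<^sub>b A"

text \<open>
  The type of matrices has no zero, so the sum of a family of \<open>n \<times> m\<close> bimatrices carries its size
  explicitly; \<open>bimat_sum_empty\<close> and \<open>bimat_sum_insert\<close> below show that this is the iterated
  bimatrix addition.
\<close>

definition bimat_sum :: "nat \<Rightarrow> nat \<Rightarrow> ('i \<Rightarrow> bimatrix) \<Rightarrow> 'i set \<Rightarrow> bimatrix" where
  "bimat_sum n m f K =
     (mat n m (\<lambda>ij. \<Sum>k\<in>K. fst (f k) $$ ij), mat n m (\<lambda>ij. \<Sum>k\<in>K. snd (f k) $$ ij))"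

definition bimat_inverts :: "nat \<Rightarrow> bimatrix \<Rightarrow> bimatrix \<Rightarrow> bool" where
  "bimat_inverts n A B \<longleftrightarrow>
     B \<in> bimat_carrier n n \<and> A \<otimes>\<^sub>b B = bimat_id n \<and> B \<otimes>\<^sub>b A = bimat_id n"

definition bimat_invertible :: "bimatrix \<Rightarrow> bool" where
  "bimat_invertible A \<longleftrightarrow> (\<exists>B. bimat_inverts (dim_row (fst A)) A B)"

text \<open>Only meaningful for an invertible square bimatrix; see \<open>bimat_inv_eq\<close>.\<close>

definition bimat_inv :: "bimatrix \<Rightarrow> bimatrix" where
  "bimat_inv A = (THE B. bimat_inverts (dim_row (fst A)) A B)"

definition bimat_lift :: "bimatrix \<Rightarrow> complex mat" where
  "bimat_lift P = four_block_mat (fst P) (conj_mat (snd P)) (snd P) (conj_mat (fst P))"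

definition bimat_spectrum :: "bimatrix \<Rightarrow> complex set" where
  "bimat_spectrum P = spectrum (bimat_lift P)"

text \<open>
  The characteristic polynomial of the lifting has real coefficients (\<open>of_real_bimat_char_poly\<close>
  below), so taking real parts merely changes its type; real coefficients are needed because
  bimatrices are only multiplied by real scalars.
\<close>

definition bimat_char_poly :: "bimatrix \<Rightarrow> real poly" where
  "bimat_char_poly P = map_poly Re (char_poly (bimat_lift P))"


lemma bimat_sum_empty: "bimat_sum n m f {} = (0\<^sub>m n m, 0\<^sub>m n m)"
  by (auto simp: bimat_sum_def)

lemma bimat_sum_insert:
  assumes "finite K" "k \<notin> K" "f k \<in> bimat_carrier n m"
  shows "bimat_sum n m f (insert k K) = f k + bimat_sum n m f K"
  using assms by (cases "f k") (auto simp: bimat_sum_def bimat_carrier_def intro!: eq_matI)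

lemma conj_mat_mult:
  assumes "A \<in> carrier_mat n m" "B \<in> carrier_mat m k"
  shows "conj_mat (A * B) = conj_mat A * conj_mat B"
  using assms by (intro eq_matI) (auto simp: scalar_prod_def)

lemma conj_mat_add:
  assumes "A \<in> carrier_mat n m" "B \<in> carrier_mat n m"
  shows "conj_mat (A + B) = conj_mat A + conj_mat B"
  using assms by (intro eq_matI) auto

lemma conj_mat_conj_mat: "conj_mat (conj_mat A) = A"
  by (intro eq_matI) auto

lemma bimat_lift_carrier:
  assumes "A \<in> bimat_carrier n m"
  shows "bimat_lift A \<in> carrier_mat (n + n) (m + m)"
  using assms by (auto simp: bimat_lift_def bimat_carrier_def)

lemma bimat_mult_carrier:
  assumes "A \<in> bimat_carrier n m" "B \<in> bimat_carrier m k"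
  shows "A \<otimes>\<^sub>b B \<in> bimat_carrier n k"
  using assms by (auto simp: bimat_mult_def bimat_carrier_def)

lemma bimat_apply_mult:
  assumes "A \<in> bimat_carrier n m" "B \<in> bimat_carrier m k" "x \<in> carrier_vec k"
  shows "bimat_apply (A \<otimes>\<^sub>b B) x = bimat_apply A (bimat_apply B x)"
proof -
  obtain A1 A2 B1 B2 where AB: "A = (A1, A2)" "B = (B1, B2)" by (metis surj_pair)
  have c: "A1 \<in> carrier_mat n m" "A2 \<in> carrier_mat n m" "B1 \<in> carrier_mat m k"
    "B2 \<in> carrier_mat m k"
    using assms AB by (auto simp: bimat_carrier_def)
  define y where "y = map_vec cnj x"
  have x: "x \<in> carrier_vec k" and y: "y \<in> carrier_vec k"
    using assms by (auto simp: y_def)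
  have cv: "map_vec cnj (B1 *\<^sub>v x + conj_mat B2 *\<^sub>v y) = conj_mat B1 *\<^sub>v y + B2 *\<^sub>v x"
    using c x by (intro eq_vecI) (auto simp: scalar_prod_def y_def)
  have cc: "conj_mat A1 \<in> carrier_mat n m" "conj_mat A2 \<in> carrier_mat n m"
    "conj_mat B1 \<in> carrier_mat m k" "conj_mat B2 \<in> carrier_mat m k"
    using c by auto
  have cm: "conj_mat (conj_mat A1 * B2 + A2 * B1) = A1 * conj_mat B2 + conj_mat A2 * conj_mat B1"
    using c cc by (simp add: conj_mat_add[of _ n k] conj_mat_mult[of _ n m _ k] conj_mat_conj_mat)
  have "bimat_apply (A \<otimes>\<^sub>b B) x =
      (A1 * B1 + conj_mat A2 * B2) *\<^sub>v x + (A1 * conj_mat B2 + conj_mat A2 * conj_mat B1) *\<^sub>v y"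
    by (simp add: AB bimat_apply_def bimat_mult_def cm y_def)
  also have "\<dots> = (A1 *\<^sub>v (B1 *\<^sub>v x) + conj_mat A2 *\<^sub>v (B2 *\<^sub>v x)) +
      (A1 *\<^sub>v (conj_mat B2 *\<^sub>v y) + conj_mat A2 *\<^sub>v (conj_mat B1 *\<^sub>v y))"
    using c cc x y
    by (simp add: add_mult_distrib_mat_vec[of _ n k] assoc_mult_mat_vec[of _ n m _ k])
  also have "\<dots> = A1 *\<^sub>v (B1 *\<^sub>v x + conj_mat B2 *\<^sub>v y) +
      conj_mat A2 *\<^sub>v (conj_mat B1 *\<^sub>v y + B2 *\<^sub>v x)"
    using c cc x y
    by (subst (1 2) mult_add_distrib_mat_vec[of _ n m]) (auto intro!: eq_vecI)
  also have "\<dots> = bimat_apply A (bimat_apply B x)"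
    by (simp add: AB bimat_apply_def cv flip: y_def)
  finally show ?thesis .
qed

lemma bimat_lift_mult:
  assumes "A \<in> bimat_carrier n m" "B \<in> bimat_carrier m k"
  shows "bimat_lift (A \<otimes>\<^sub>b B) = bimat_lift A * bimat_lift B"
proof -
  obtain A1 A2 B1 B2 where AB: "A = (A1, A2)" "B = (B1, B2)" by (metis surj_pair)
  have c: "A1 \<in> carrier_mat n m" "A2 \<in> carrier_mat n m" "B1 \<in> carrier_mat m k"
    "B2 \<in> carrier_mat m k"
    using assms AB by (auto simp: bimat_carrier_def)
  have cc: "conj_mat A1 \<in> carrier_mat n m" "conj_mat A2 \<in> carrier_mat n m"
    "conj_mat B1 \<in> carrier_mat m k" "conj_mat B2 \<in> carrier_mat m k"
    using c by auto
  show ?thesis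
    unfolding AB bimat_lift_def bimat_mult_def fst_conv snd_conv
    using c cc
    by (subst mult_four_block_mat[of _ n m _ m _ n _ _ k _ k])
       (auto simp: conj_mat_add[of _ n k] conj_mat_mult[of _ n m _ k] conj_mat_conj_mat
          comm_add_mat[of _ n k])
qed

lemma bimat_lift_id: "bimat_lift (bimat_id n) = 1\<^sub>m (n + n)"
  by (intro eq_matI) (auto simp: bimat_lift_def bimat_id_def)

lemma bimat_lift_inj:
  assumes "A \<in> bimat_carrier n m" "B \<in> bimat_carrier n m" "bimat_lift A = bimat_lift B"
  shows "A = B"
proof -
  obtain A1 A2 B1 B2 where AB: "A = (A1, A2)" "B = (B1, B2)" by (metis surj_pair)
  have c: "A1 \<in> carrier_mat n m" "A2 \<in> carrier_mat n m" "B1 \<in> carrier_mat n m"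
    "B2 \<in> carrier_mat n m"
    using assms AB by (auto simp: bimat_carrier_def)
  have eq: "bimat_lift A $$ (i, j) = bimat_lift B $$ (i, j)" for i j
    using assms by simp
  have "A1 $$ (i, j) = B1 $$ (i, j)" "A2 $$ (i, j) = B2 $$ (i, j)" if "i < n" "j < m" for i j
    using eq[of i j] eq[of "n + i" j] that c by (auto simp: bimat_lift_def AB)
  then show ?thesis
    using c by (auto simp: AB intro!: eq_matI)
qed

lemma bimat_inv_eq:
  assumes A: "A \<in> bimat_carrier n n" and B: "bimat_inverts n A B"
  shows "bimat_inv A = B"
proof -
  have dim: "dim_row (fst A) = n"
    using A by (auto simp: bimat_carrier_def)
  have "B' = B" if B': "bimat_inverts n A B'" for B'
  proof -
    have c: "B \<in> bimat_carrier n n" "B' \<in> bimat_carrier n n"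
      using B B' by (auto simp: bimat_inverts_def)
    let ?L = bimat_lift
    have L: "?L A \<in> carrier_mat (n+n) (n+n)" "?L B \<in> carrier_mat (n+n) (n+n)"
      "?L B' \<in> carrier_mat (n+n) (n+n)"
      using A c by (auto intro: bimat_lift_carrier)
    have 1: "?L B' * ?L A = 1\<^sub>m (n+n)" "?L A * ?L B = 1\<^sub>m (n+n)"
      using A B B' c
      by (auto simp: bimat_inverts_def bimat_lift_id simp flip: bimat_lift_mult[of _ n n _ n])
    have "?L B' = ?L B' * (?L A * ?L B)" using 1 L by simp
    also have "\<dots> = (?L B' * ?L A) * ?L B" using L by (simp add: assoc_mult_mat[of _ "n+n" "n+n" _ "n+n" _ "n+n"])
    also have "\<dots> = ?L B" using 1 L by simp
    finally show ?thesis using c bimat_lift_inj by blast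
  qed
  then show ?thesis
    unfolding bimat_inv_def dim using B by blast
qed

lemma of_real_bimat_char_poly:
  assumes P: "P \<in> bimat_carrier n n"
  shows "map_poly complex_of_real (bimat_char_poly P) = char_poly (bimat_lift P)"
proof -
  let ?L = "bimat_lift P"
  let ?J = "four_block_mat (0\<^sub>m n n) (1\<^sub>m n) (1\<^sub>m n) (0\<^sub>m n n) :: complex mat"
  obtain P1 P2 where P12: "P = (P1, P2)" by (metis surj_pair)
  have c: "P1 \<in> carrier_mat n n" "P2 \<in> carrier_mat n n"
    "conj_mat P1 \<in> carrier_mat n n" "conj_mat P2 \<in> carrier_mat n n"
    using P P12 by (auto simp: bimat_carrier_def)
  have L: "?L \<in> carrier_mat (n+n) (n+n)"
    using P by (rule bimat_lift_carrier)
  have conjL: "conj_mat ?L = four_block_mat (conj_mat P1) P2 (conj_mat P2) P1"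
    using c by (simp add: bimat_lift_def P12 map_four_block_mat[of _ n n _ n _ n] conj_mat_conj_mat)
  have JJ: "?J * ?J = 1\<^sub>m (n+n)"
    by (subst mult_four_block_mat[of _ n n _ n _ n _ _ n _ n]) (auto intro!: eq_matI)
  have "?J * conj_mat ?L = four_block_mat (conj_mat P2) P1 (conj_mat P1) P2"
    unfolding conjL using c by (subst mult_four_block_mat[of _ n n _ n _ n _ _ n _ n]) auto
  then have "?J * conj_mat ?L * ?J = ?L"
    using c by (simp add: bimat_lift_def P12, subst mult_four_block_mat[of _ n n _ n _ n _ _ n _ n]) auto
  then have "similar_mat_wit ?L (conj_mat ?L) ?J ?J"
    using L JJ by (auto simp: similar_mat_wit_def Let_def)
  then have "char_poly ?L = char_poly (conj_mat ?L)"
    by (intro char_poly_similar) (auto simp: similar_mat_def)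
  also have "\<dots> = map_poly cnj (char_poly ?L)"
  proof -
    interpret cnj: comm_ring_hom cnj by standard auto
    show ?thesis using cnj.char_poly_hom[OF L] by simp
  qed
  finally have "coeff (char_poly ?L) i = cnj (coeff (char_poly ?L) i)" for i
    by (metis coeff_map_poly complex_cnj_zero)
  then have "complex_of_real (Re (coeff (char_poly ?L) i)) = coeff (char_poly ?L) i" for i
    by (metis Reals_cnj_iff of_real_Re)
  then show ?thesis
    by (intro poly_eqI) (simp add: bimat_char_poly_def coeff_map_poly)
qed

end

theory Submission
  imports Defs
begin

text \<open>
  Put \<open>D 0 = 0\<close>. Telescoping gives \<open>A D(k) - D(k) F = A\<^sup>k C - C F\<^sup>k\<close>, and
  \<open>A\<^sup>k X - X F\<^sup>k = D(k)\<close> for every solution \<open>X\<close>. Weighting with the coefficients of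
  \<open>\<beta>\<close>, where \<open>\<beta>(F) = 0\<close> by Cayley--Hamilton, turns these into
  \<open>A R - R F = \<beta>(A) C\<close> and \<open>\<beta>(A) X = R\<close>, with \<open>R\<close> the weighted sum of the \<open>D(k)\<close>.
  If the spectra are disjoint, \<open>\<beta>(A)\<close> is a product of invertible factors \<open>A - e I\<close>, so \<open>\<beta>(A)\<^sup>-\<^sup>1 R\<close>
  is the only solution. For a common eigenvalue, a right eigenvector \<open>u\<close> of \<open>A\<close> and a left
  eigenvector \<open>v\<close> of \<open>F\<close> give a nonzero solution \<open>u v\<^sup>T\<close> of the lifted homogeneous equation,
  which is symmetrized to a nonzero bimatrix. All computations take place in the complex lifting.
\<close>

section \<open>Sums of matrices\<close>

text \<open>The explicit size gives the empty sum a definite shape, as in \<open>bimat_sum\<close>;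
  the entrywise form reduces the laws below to those of \<open>sum\<close>.\<close>

definition mat_sum :: "nat \<Rightarrow> nat \<Rightarrow> ('i \<Rightarrow> 'a :: comm_monoid_add mat) \<Rightarrow> 'i set \<Rightarrow> 'a mat" where
  "mat_sum n m f K = mat n m (\<lambda>ij. \<Sum>k\<in>K. f k $$ ij)"

lemma mat_sum_carrier [simp]: "mat_sum n m f K \<in> carrier_mat n m"
  by (simp add: mat_sum_def)

lemma mat_sum_dim [simp]: "dim_row (mat_sum n m f K) = n" "dim_col (mat_sum n m f K) = m"
  by (simp_all add: mat_sum_def)

lemma mat_sum_cong:
  assumes "\<And>k. k \<in> K \<Longrightarrow> f k = g k"
  shows "mat_sum n m f K = mat_sum n m g K"
  using assms by (intro eq_matI) (auto simp: mat_sum_def)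

lemma mat_sum_empty: "mat_sum n m f {} = 0\<^sub>m n m"
  by (intro eq_matI) (auto simp: mat_sum_def)

lemma mat_sum_lessThan_Suc:
  assumes "f k \<in> carrier_mat n m"
  shows "mat_sum n m f {..<Suc k} = mat_sum n m f {..<k} + f k"
  using assms by (intro eq_matI) (auto simp: mat_sum_def)

lemma mat_sum_mono_neutral:
  assumes "finite T" "K \<subseteq> T" "\<And>k. k \<in> T - K \<Longrightarrow> f k = 0\<^sub>m n m"
  shows "mat_sum n m f K = mat_sum n m f T"
  using assms by (intro eq_matI) (auto simp: mat_sum_def intro!: sum.mono_neutral_left)

lemma mat_sum_add:
  assumes "\<And>k. k \<in> K \<Longrightarrow> f k \<in> carrier_mat n m" "\<And>k. k \<in> K \<Longrightarrow> g k \<in> carrier_mat n m"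
  shows "mat_sum n m (\<lambda>k. f k + g k) K = mat_sum n m f K + mat_sum n m g K"
proof -
  have dim: "dim_row (g k) = n" "dim_col (g k) = m" if "k \<in> K" for k
    using assms(2)[OF that] by auto
  show ?thesis
    by (intro eq_matI) (auto simp: mat_sum_def dim sum.distrib[symmetric] intro!: sum.cong)
qed

lemma mat_sum_mult_left:
  fixes A :: "'a :: comm_semiring_0 mat"
  assumes A: "A \<in> carrier_mat l n" and f: "\<And>k. k \<in> K \<Longrightarrow> f k \<in> carrier_mat n m"
  shows "A * mat_sum n m f K = mat_sum l m (\<lambda>k. A * f k) K"
proof (intro eq_matI)
  fix i j assume "i < dim_row (mat_sum l m (\<lambda>k. A * f k) K)"
    "j < dim_col (mat_sum l m (\<lambda>k. A * f k) K)"
  then have ij: "i < l" "j < m" by auto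
  have "(A * mat_sum n m f K) $$ (i, j) = (\<Sum>r = 0..<n. A $$ (i, r) * (\<Sum>k\<in>K. f k $$ (r, j)))"
    using A ij by (simp add: scalar_prod_def mat_sum_def)
  also have "\<dots> = (\<Sum>k\<in>K. \<Sum>r = 0..<n. A $$ (i, r) * f k $$ (r, j))"
    by (subst sum.swap) (simp add: sum_distrib_left)
  also have "\<dots> = (\<Sum>k\<in>K. (A * f k) $$ (i, j))"
  proof (intro sum.cong refl)
    fix k assume "k \<in> K"
    from f[OF this] show "(\<Sum>r = 0..<n. A $$ (i, r) * f k $$ (r, j)) = (A * f k) $$ (i, j)"
      using A ij by (simp add: scalar_prod_def)
  qed
  finally show "(A * mat_sum n m f K) $$ (i, j) = mat_sum l m (\<lambda>k. A * f k) K $$ (i, j)"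
    using ij by (simp add: mat_sum_def)
qed (use A in auto)

lemma mat_sum_mult_right:
  fixes A :: "'a :: comm_semiring_0 mat"
  assumes A: "A \<in> carrier_mat m l" and f: "\<And>k. k \<in> K \<Longrightarrow> f k \<in> carrier_mat n m"
  shows "mat_sum n m f K * A = mat_sum n l (\<lambda>k. f k * A) K"
proof (intro eq_matI)
  fix i j assume "i < dim_row (mat_sum n l (\<lambda>k. f k * A) K)"
    "j < dim_col (mat_sum n l (\<lambda>k. f k * A) K)"
  then have ij: "i < n" "j < l" by auto
  have "(mat_sum n m f K * A) $$ (i, j) = (\<Sum>r = 0..<m. (\<Sum>k\<in>K. f k $$ (i, r)) * A $$ (r, j))"
    using A ij by (simp add: scalar_prod_def mat_sum_def)
  also have "\<dots> = (\<Sum>k\<in>K. \<Sum>r = 0..<m. f k $$ (i, r) * A $$ (r, j))"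
    by (subst sum.swap) (simp add: sum_distrib_right)
  also have "\<dots> = (\<Sum>k\<in>K. (f k * A) $$ (i, j))"
  proof (intro sum.cong refl)
    fix k assume "k \<in> K"
    from f[OF this] show "(\<Sum>r = 0..<m. f k $$ (i, r) * A $$ (r, j)) = (f k * A) $$ (i, j)"
      using A ij by (simp add: scalar_prod_def)
  qed
  finally show "(mat_sum n m f K * A) $$ (i, j) = mat_sum n l (\<lambda>k. f k * A) K $$ (i, j)"
    using ij by (simp add: mat_sum_def)
qed (use A in auto)

section \<open>Polynomials of matrices and the Cayley--Hamilton theorem\<close>

lemma pow_mat_Suc_left:
  assumes "A \<in> carrier_mat n n"
  shows "A * A ^\<^sub>m k = A ^\<^sub>m Suc k"
proof (induction k)
  case (Suc k)
  have "A * (A ^\<^sub>m k * A) = (A * A ^\<^sub>m k) * A"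
    by (rule assoc_mult_mat[symmetric]) (use assms in auto)
  then show ?case by (simp only: Suc pow_mat.simps)
qed (use assms in auto)

definition mat_poly :: "'a :: comm_ring_1 poly \<Rightarrow> 'a mat \<Rightarrow> 'a mat" where
  "mat_poly q A =
     mat_sum (dim_row A) (dim_row A) (\<lambda>k. coeff q k \<cdot>\<^sub>m A ^\<^sub>m k) {..degree q}"

lemma mat_poly_carrier [simp]: "A \<in> carrier_mat n n \<Longrightarrow> mat_poly q A \<in> carrier_mat n n"
  by (auto simp: mat_poly_def)

text \<open>Coefficients beyond the degree vanish, so any degree bound can be the upper limit; later
  it is \<open>2 * p\<close>.\<close>

lemma mat_poly_upto:
  assumes A: "A \<in> carrier_mat n n" and N: "degree q \<le> N"
  shows "mat_poly q A = mat_sum n n (\<lambda>k. coeff q k \<cdot>\<^sub>m A ^\<^sub>m k) {..N}"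
proof -
  have "mat_sum n n (\<lambda>k. coeff q k \<cdot>\<^sub>m A ^\<^sub>m k) {..degree q} =
      mat_sum n n (\<lambda>k. coeff q k \<cdot>\<^sub>m A ^\<^sub>m k) {..N}"
  proof (rule mat_sum_mono_neutral)
    show "coeff q k \<cdot>\<^sub>m A ^\<^sub>m k = 0\<^sub>m n n" if "k \<in> {..N} - {..degree q}" for k
      using that A by (intro eq_matI) (auto simp: coeff_eq_0)
  qed (use N in auto)
  then show ?thesis
    using A by (simp add: mat_poly_def)
qed

lemma mat_poly_1:
  assumes "A \<in> carrier_mat n n"
  shows "mat_poly 1 A = 1\<^sub>m n"
  using assms by (simp add: mat_poly_def) (simp add: mat_sum_def, intro eq_matI, simp_all)

lemma smult_smult_mat: "a \<cdot>\<^sub>m (b \<cdot>\<^sub>m A) = (a * b :: 'a :: semiring_1) \<cdot>\<^sub>m A"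
  by (intro eq_matI) (auto simp: mult.assoc)

text \<open>\<open>char_matrix A e\<close> is A - e I, the value of the linear factor at A. This
  case of multiplicativity suffices for polynomials that split.\<close>

lemma mat_poly_linear_mult:
  fixes A :: "'a :: field mat"
  assumes A: "A \<in> carrier_mat n n"
  shows "mat_poly ([:- e, 1:] * q) A = mat_poly q A * char_matrix A e"
proof -
  define N where "N = degree q"
  have pw: "A ^\<^sub>m k \<in> carrier_mat n n" for k using A by simp
  have cA: "char_matrix A e \<in> carrier_mat n n" using A by simp
  have deg: "degree ([:- e, 1:] * q) \<le> Suc N"
    using degree_mult_le[of "[:- e, 1:]" q] by (simp add: N_def)
  have step: "(coeff q k \<cdot>\<^sub>m A ^\<^sub>m k) * char_matrix A e
      = coeff q k \<cdot>\<^sub>m A ^\<^sub>m Suc k + (- (e * coeff q k)) \<cdot>\<^sub>m A ^\<^sub>m k" for k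
  proof -
    have "A ^\<^sub>m k * char_matrix A e = A ^\<^sub>m Suc k + (- e) \<cdot>\<^sub>m A ^\<^sub>m k"
      using A pw[of k] unfolding char_matrix_def
      by (simp add: mult_add_distrib_mat[of _ n n _ n] mult_smult_distrib[of _ n n _ n])
    then have "(coeff q k \<cdot>\<^sub>m A ^\<^sub>m k) * char_matrix A e
        = coeff q k \<cdot>\<^sub>m (A ^\<^sub>m Suc k + (- e) \<cdot>\<^sub>m A ^\<^sub>m k)"
      using pw[of k] cA by (simp add: mult_smult_assoc_mat[of _ n n _ n])
    also have "\<dots> = coeff q k \<cdot>\<^sub>m A ^\<^sub>m Suc k + (- (e * coeff q k)) \<cdot>\<^sub>m A ^\<^sub>m k"
      using pw[of k] pw[of "Suc k"]
      by (simp add: add_smult_distrib_left_mat[of _ n n] smult_smult_mat ac_simps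
          del: pow_mat.simps)
    finally show ?thesis .
  qed
  have "mat_poly q A * char_matrix A e =
      mat_sum n n (\<lambda>k. coeff q k \<cdot>\<^sub>m A ^\<^sub>m Suc k + (- (e * coeff q k)) \<cdot>\<^sub>m A ^\<^sub>m k) {..N}"
    using A pw cA
    by (simp add: mat_poly_upto[OF A order_refl] mat_sum_mult_right[of _ n n] step N_def
        del: pow_mat.simps)
  also have "\<dots> = mat_sum n n (\<lambda>k. coeff ([:- e, 1:] * q) k \<cdot>\<^sub>m A ^\<^sub>m k) {..Suc N}"
  proof (intro eq_matI)
    fix i j assume "i < dim_row (mat_sum n n (\<lambda>k. coeff ([:- e, 1:] * q) k \<cdot>\<^sub>m A ^\<^sub>m k) {..Suc N})"
      "j < dim_col (mat_sum n n (\<lambda>k. coeff ([:- e, 1:] * q) k \<cdot>\<^sub>m A ^\<^sub>m k) {..Suc N})"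
    then have ij: "i < n" "j < n" by auto
    have "(\<Sum>k\<le>Suc N. coeff ([:- e, 1:] * q) k * (A ^\<^sub>m k) $$ (i, j)) =
        (\<Sum>k\<le>Suc N. coeff (pCons 0 q) k * (A ^\<^sub>m k) $$ (i, j)) +
        (\<Sum>k\<le>Suc N. - (e * coeff q k) * (A ^\<^sub>m k) $$ (i, j))"
      by (simp add: sum.distrib[symmetric] algebra_simps del: sum.atMost_Suc pow_mat.simps)
    \<comment> \<open>\<open>pCons 0 q\<close> is s times q: its constant coefficient is 0 and the
      others are shifted by one place.\<close>
    also have "(\<Sum>k\<le>Suc N. coeff (pCons 0 q) k * (A ^\<^sub>m k) $$ (i, j)) =
        (\<Sum>k\<le>N. coeff q k * (A ^\<^sub>m Suc k) $$ (i, j))"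
      by (subst sum.atMost_Suc_shift) (simp del: pow_mat.simps)
    \<comment> \<open>The top term vanishes because \<open>Suc N\<close> exceeds the degree of
      \<open>q\<close>.\<close>
    also have "(\<Sum>k\<le>Suc N. - (e * coeff q k) * (A ^\<^sub>m k) $$ (i, j)) =
        (\<Sum>k\<le>N. - (e * coeff q k) * (A ^\<^sub>m k) $$ (i, j))"
      by (simp add: N_def coeff_eq_0)
    finally show "mat_sum n n (\<lambda>k. coeff q k \<cdot>\<^sub>m A ^\<^sub>m Suc k + (- (e * coeff q k)) \<cdot>\<^sub>m A ^\<^sub>m k) {..N} $$ (i, j)
       = mat_sum n n (\<lambda>k. coeff ([:- e, 1:] * q) k \<cdot>\<^sub>m A ^\<^sub>m k) {..Suc N} $$ (i, j)"
      using ij A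
      by (simp add: mat_sum_def sum.distrib sum_subtractf sum_negf del: sum.atMost_Suc pow_mat.simps mult_pCons_left)
  qed auto
  also have "\<dots> = mat_poly ([:- e, 1:] * q) A"
    using mat_poly_upto[OF A deg] by simp
  finally show ?thesis by simp
qed

lemma det_mat_poly_linear_factors:
  fixes A :: "'a :: field mat"
  assumes A: "A \<in> carrier_mat n n"
  shows "det (mat_poly (\<Prod>e\<leftarrow>es. [:- e, 1:]) A) = (\<Prod>e\<leftarrow>es. det (char_matrix A e))"
proof (induction es)
  case (Cons e es)
  then show ?case
    using A by (simp add: mat_poly_linear_mult[OF A] det_mult[of _ n] del: mult_pCons_left)
qed (use A in \<open>simp add: mat_poly_1\<close>)

text \<open>Over the complex numbers \<open>char_poly F\<close> splits, its roots are the
  eigenvalues of F, and disjointness makes A - e I invertible at each of them.\<close>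

lemma det_mat_poly_char_poly_nonzero:
  fixes A F :: "complex mat"
  assumes A: "A \<in> carrier_mat n n" and F: "F \<in> carrier_mat m m"
    and disj: "spectrum A \<inter> spectrum F = {}"
  shows "det (mat_poly (char_poly F) A) \<noteq> 0"
proof -
  obtain es where es: "char_poly F = (\<Prod>e\<leftarrow>es. [:- e, 1:])"
    using char_poly_factorized[OF F] by blast
  have "det (char_matrix A e) \<noteq> 0" if "e \<in> set es" for e
  proof -
    have "poly (char_poly F) e = 0"
      using that unfolding es by (auto simp: poly_prod_list prod_list_zero_iff)
    then have "e \<in> spectrum F"
      by (simp add: spectrum_def eigenvalue_root_char_poly[OF F])
    then show ?thesis
      using disj by (auto simp: spectrum_def eigenvalue_det[OF A, symmetric])
  qed
  then show ?thesis
    unfolding es det_mat_poly_linear_factors[OF A] by (auto simp: prod_list_zero_iff)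
qed

text \<open>
  Comparing coefficients in \<open>adj (s I - A) * (s I - A) = char_poly A * I\<close> expresses each
  coefficient of the characteristic polynomial through the coefficient matrices \<open>B\<close> of the
  adjugate, and the sum for \<open>mat_poly (char_poly A) A\<close> telescopes.
\<close>

theorem cayley_hamilton:
  fixes A :: "'a :: comm_ring_1 mat"
  assumes A: "A \<in> carrier_mat n n"
  shows "mat_poly (char_poly A) A = 0\<^sub>m n n"
proof -
  define M where "M = char_poly_matrix A"
  define P where "P = adj_mat M"
  define q where "q = char_poly A"
  have M: "M \<in> carrier_mat n n" using A by (simp add: M_def)
  have P: "P \<in> carrier_mat n n" and PM: "P * M = q \<cdot>\<^sub>m 1\<^sub>m n"
    using adj_mat[OF M] by (simp_all add: P_def q_def char_poly_def M_def)
  \<comment> \<open>\<open>B k\<close> is the matrix coefficient of s^k in the adjugate of s I -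
    A.\<close>
  define B where "B k = map_mat (\<lambda>r. coeff r k) P" for k
  have B: "B k \<in> carrier_mat n n" for k using P by (simp add: B_def)
  have pw: "A ^\<^sub>m k \<in> carrier_mat n n" for k using A by simp
  have entry: "(\<Sum>l = 0..<n. P $$ (i, l) * M $$ (l, j)) = (if i = j then q else 0)"
    if "i < n" "j < n" for i j
    using arg_cong[OF PM, of "\<lambda>X. X $$ (i, j)"] that M P by (simp add: scalar_prod_def)
  have Mlj: "M $$ (l, j) = (if l = j then [:0, 1:] else 0) - [:A $$ (l, j):]"
    if "l < n" "j < n" for l j
    using that A by (simp add: M_def char_poly_matrix_def)
  \<comment> \<open>This is entry (i, j) of adj (s I - A) * (s I - A), with \<open>pCons 0\<close>
    as multiplication by s.\<close>
  have key: "pCons 0 (P $$ (i, j)) - (\<Sum>l = 0..<n. Polynomial.smult (A $$ (l, j)) (P $$ (i, l)))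
      = (if i = j then q else 0)" if "i < n" "j < n" for i j
  proof -
    have "(\<Sum>l = 0..<n. P $$ (i, l) * M $$ (l, j)) =
        (\<Sum>l = 0..<n. (if l = j then pCons 0 (P $$ (i, j)) else 0) - Polynomial.smult (A $$ (l, j)) (P $$ (i, l)))"
      using that by (intro sum.cong) (auto simp: Mlj algebra_simps)
    also have "\<dots> = pCons 0 (P $$ (i, j)) - (\<Sum>l = 0..<n. Polynomial.smult (A $$ (l, j)) (P $$ (i, l)))"
      using that by (simp add: sum_subtractf)
    finally show ?thesis using entry[OF that] by simp
  qed
  \<comment> \<open>On the right stands 0 for k = 0 and otherwise an entry of
    \<open>B (k - 1)\<close>; these are the cases \<open>z\<close> and \<open>s\<close>
    below.\<close>
  have coeffs: "(if i = j then coeff q k else 0) + (B k * A) $$ (i, j) = coeff (pCons 0 (P $$ (i, j))) k"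
    if "i < n" "j < n" for i j k
    using arg_cong[OF key[OF that], of "\<lambda>r. coeff r k"] that A P
    by (simp add: coeff_sum scalar_prod_def B_def mult.commute diff_eq_eq split: if_splits)
  have z: "coeff q 0 \<cdot>\<^sub>m 1\<^sub>m n + B 0 * A = 0\<^sub>m n n"
  proof (intro eq_matI)
    fix i j assume "i < dim_row (0\<^sub>m n n)" "j < dim_col (0\<^sub>m n n)"
    then have ij: "i < n" "j < n" by auto
    then show "(coeff q 0 \<cdot>\<^sub>m 1\<^sub>m n + B 0 * A) $$ (i, j) = 0\<^sub>m n n $$ (i, j)"
      using coeffs[OF ij, of 0] A B[of 0]
      by (auto simp del: index_mult_mat(1) split: if_splits)
  qed (use A B in auto)
  have s: "coeff q (Suc k) \<cdot>\<^sub>m 1\<^sub>m n + B (Suc k) * A = B k" for k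
  proof (intro eq_matI)
    fix i j assume "i < dim_row (B k)" "j < dim_col (B k)"
    then have ij: "i < n" "j < n" using B[of k] by auto
    then show "(coeff q (Suc k) \<cdot>\<^sub>m 1\<^sub>m n + B (Suc k) * A) $$ (i, j) = B k $$ (i, j)"
      using coeffs[OF ij, of "Suc k"] A P B[of "Suc k"]
      by (auto simp: B_def simp del: index_mult_mat(1) split: if_splits)
  qed (use A B[of k] B[of "Suc k"] in auto)
  let ?T = "\<lambda>N. mat_sum n n (\<lambda>k. coeff q k \<cdot>\<^sub>m A ^\<^sub>m k) {..<N}"
  \<comment> \<open>Telescoping invariant: a single remainder cancels the partial sum. Equation
    \<open>s\<close>, multiplied by \<open>A ^\<^sub>m Suc N\<close>, trades the remainder for the
    next term and the next remainder.\<close>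
  have T: "?T (Suc N) + B N * A ^\<^sub>m Suc N = 0\<^sub>m n n" for N
  proof (induction N)
    case 0
    have "?T 1 = coeff q 0 \<cdot>\<^sub>m 1\<^sub>m n"
      using A by (intro eq_matI) (auto simp: mat_sum_def)
    then show ?case using z A by simp
  next
    case (Suc N)
    let ?X = "A ^\<^sub>m Suc N"
    have X: "?X \<in> carrier_mat n n" using A by (rule pow_carrier_mat)
    have "?T (Suc (Suc N)) + B (Suc N) * A ^\<^sub>m Suc (Suc N)
        = ?T (Suc N) + (coeff q (Suc N) \<cdot>\<^sub>m ?X + B (Suc N) * (A * ?X))"
      unfolding pow_mat_Suc_left[OF A]
      using A B[of "Suc N"] X
      by (subst mat_sum_lessThan_Suc)
        (auto simp: assoc_add_mat[of _ n n] simp del: pow_mat.simps)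
    also have "coeff q (Suc N) \<cdot>\<^sub>m ?X + B (Suc N) * (A * ?X)
        = (coeff q (Suc N) \<cdot>\<^sub>m 1\<^sub>m n + B (Suc N) * A) * ?X"
      using A B[of "Suc N"] X
      by (simp add: add_mult_distrib_mat[of _ n n _ _ n] mult_smult_assoc_mat[of _ n n _ n]
          assoc_mult_mat[of _ n n _ n _ n] del: pow_mat.simps)
    also have "\<dots> = B N * ?X" by (simp only: s)
    finally show ?case using Suc by simp
  qed
  \<comment> \<open>N exceeds the degrees of \<open>q\<close> and of all adjugate entries, so the
    remainder is zero and the partial sum complete. The double sum is a crude bound that also makes
    sense for n = 0.\<close>
  define N where "N = degree q + (\<Sum>i<n. \<Sum>j<n. degree (P $$ (i, j))) + 1"
  have "degree (P $$ (i, j)) < N" if "i < n" "j < n" for i j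
  proof -
    have "degree (P $$ (i, j)) \<le> (\<Sum>j<n. degree (P $$ (i, j)))"
      using that by (intro member_le_sum) auto
    also have "\<dots> \<le> (\<Sum>i<n. \<Sum>j<n. degree (P $$ (i, j)))"
      using that by (intro member_le_sum[of i "{..<n}" "\<lambda>i. \<Sum>j<n. degree (P $$ (i, j))"]) auto
    finally show ?thesis by (simp add: N_def)
  qed
  then have "B N = 0\<^sub>m n n"
    using P by (intro eq_matI) (auto simp: B_def coeff_eq_0)
  then have "?T (Suc N) = 0\<^sub>m n n"
    using T[of N] A by (simp del: pow_mat.simps)
  moreover have "mat_poly q A = ?T (Suc N)"
    using mat_poly_upto[OF A, of q N] by (simp add: N_def lessThan_Suc_atMost)
  ultimately show ?thesis by (simp add: q_def)
qed

section \<open>The Sylvester equation over a field\<close>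

text \<open>Both identities follow by induction from D(k+1) = D(k) F + A^k C. They are stated with
  sums in place of differences, hence hold over semirings.\<close>

lemma
  fixes A F C :: "'a :: comm_semiring_1 mat"
  assumes A: "A \<in> carrier_mat n n" and F: "F \<in> carrier_mat m m" and C: "C \<in> carrier_mat n m"
  defines "D \<equiv> \<lambda>k. mat_sum n m (\<lambda>i. A ^\<^sub>m i * C * F ^\<^sub>m (k - 1 - i)) {..<k}"
  shows sylvester_telescope_comm: "A * D k + C * F ^\<^sub>m k = A ^\<^sub>m k * C + D k * F"
    and sylvester_telescope_solution:
      "X \<in> carrier_mat n m \<Longrightarrow> A * X = C + X * F \<Longrightarrow> A ^\<^sub>m k * X = D k + X * F ^\<^sub>m k"
proof -
  have pA: "A ^\<^sub>m k \<in> carrier_mat n n" for k using A by (rule pow_carrier_mat)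
  have pF: "F ^\<^sub>m k \<in> carrier_mat m m" for k using F by (rule pow_carrier_mat)
  have t: "A ^\<^sub>m i * C * F ^\<^sub>m j \<in> carrier_mat n m" for i j
    using pA pF C by (meson mult_carrier_mat)
  have D: "D k \<in> carrier_mat n m" for k by (simp add: D_def)
  note cl = A F C pA pF D mult_carrier_mat[of _ n n _ m] mult_carrier_mat[of _ n m _ m]
    mult_carrier_mat[of _ n n _ n] mult_carrier_mat[of _ m m _ m]
  have D0: "D 0 = 0\<^sub>m n m" by (simp add: D_def mat_sum_empty)
  \<comment> \<open>The summand i = k carries the zeroth power of F and gives A^k C; every earlier
    summand gains one factor F.\<close>
  have DS: "D (Suc k) = D k * F + A ^\<^sub>m k * C" for k
  proof -
    have "D (Suc k) = mat_sum n m (\<lambda>i. A ^\<^sub>m i * C * F ^\<^sub>m (k - i)) {..<k} + A ^\<^sub>m k * C"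
      by (simp add: D_def mat_sum_lessThan_Suc[OF t] carrier_matD(1)[OF F]
          right_mult_one_mat[of _ n m] cl)
    also have "mat_sum n m (\<lambda>i. A ^\<^sub>m i * C * F ^\<^sub>m (k - i)) {..<k} =
        mat_sum n m (\<lambda>i. A ^\<^sub>m i * C * F ^\<^sub>m (k - 1 - i) * F) {..<k}"
    proof (rule mat_sum_cong)
      fix i assume "i \<in> {..<k}"
      then have "k - i = Suc (k - 1 - i)" by auto
      then have "F ^\<^sub>m (k - i) = F ^\<^sub>m (k - 1 - i) * F" by simp
      then show "A ^\<^sub>m i * C * F ^\<^sub>m (k - i) = A ^\<^sub>m i * C * F ^\<^sub>m (k - 1 - i) * F"
        by (simp add: assoc_mult_mat[of "A ^\<^sub>m i * C" n m _ m _ m] cl)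
    qed
    also have "\<dots> = D k * F"
      unfolding D_def by (rule mat_sum_mult_right[OF F t, symmetric])
    finally show ?thesis .
  qed
  show "A * D k + C * F ^\<^sub>m k = A ^\<^sub>m k * C + D k * F"
  proof (induction k)
    case 0
    show ?case using A F C by (simp add: D0)
  next
    case (Suc k)
    have "A * D (Suc k) + C * F ^\<^sub>m Suc k = (A * D k * F + A * A ^\<^sub>m k * C) + C * F ^\<^sub>m k * F"
      unfolding DS
      by (simp add: mult_add_distrib_mat[of _ n n _ m] assoc_mult_mat[of _ n n _ n _ m]
          assoc_mult_mat[of _ n n _ m _ m] assoc_mult_mat[of _ n m _ m _ m] cl)
    also have "\<dots> = (A * D k + C * F ^\<^sub>m k) * F + A * A ^\<^sub>m k * C"
      by (simp add: add_mult_distrib_mat[of _ n m _ _ m] cl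
          assoc_add_mat[of _ n m] comm_add_mat[of "A * A ^\<^sub>m k * C" n m])
    also have "\<dots> = A ^\<^sub>m Suc k * C + (D k * F + A ^\<^sub>m k * C) * F"
      unfolding Suc pow_mat_Suc_left[OF A]
      by (subst comm_add_mat[of _ n m]) (auto simp: cl comm_add_mat[of _ n m] simp del: pow_mat.simps)
    finally show ?case by (simp only: DS)
  qed
  show "A ^\<^sub>m k * X = D k + X * F ^\<^sub>m k"
    if X: "X \<in> carrier_mat n m" and eq: "A * X = C + X * F"
  proof (induction k)
    case 0
    show ?case using A F X by (simp add: D0)
  next
    case (Suc k)
    have "A ^\<^sub>m Suc k * X = A ^\<^sub>m k * (A * X)"
      by (simp add: assoc_mult_mat[of _ n n _ n _ m] cl X)
    also have "\<dots> = A ^\<^sub>m k * C + (A ^\<^sub>m k * X) * F"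
      unfolding eq
      by (simp add: mult_add_distrib_mat[of _ n n _ m] assoc_mult_mat[of _ n n _ m _ m] cl X)
    also have "\<dots> = A ^\<^sub>m k * C + (D k * F + X * F ^\<^sub>m Suc k)"
      unfolding Suc
      by (simp add: add_mult_distrib_mat[of _ n m _ _ m] assoc_mult_mat[of _ n m _ m _ m] cl X)
    also have "\<dots> = D (Suc k) + X * F ^\<^sub>m Suc k"
      unfolding DS
      by (simp add: assoc_add_mat[of _ n m, symmetric] comm_add_mat[of "A ^\<^sub>m k * C" n m] cl X
          del: pow_mat.simps)
    finally show ?case .
  qed
qed

text \<open>The \<open>c k\<close> stand for the coefficients of a polynomial annihilating F, and S
  is its value at A. Uniqueness comes from S X = R; existence from A R = S C + R F, because S
  commutes with A and can be cancelled.\<close>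

lemma sylvester_mat_solution:
  fixes A F C :: "'a :: field mat" and c :: "nat \<Rightarrow> 'a" and K :: "nat set"
  assumes A: "A \<in> carrier_mat n n" and F: "F \<in> carrier_mat m m" and C: "C \<in> carrier_mat n m"
  defines "D \<equiv> \<lambda>k. mat_sum n m (\<lambda>i. A ^\<^sub>m i * C * F ^\<^sub>m (k - 1 - i)) {..<k}"
  defines "S \<equiv> mat_sum n n (\<lambda>k. c k \<cdot>\<^sub>m A ^\<^sub>m k) K"
  defines "R \<equiv> mat_sum n m (\<lambda>k. c k \<cdot>\<^sub>m D k) K"
  assumes annihilates: "mat_sum m m (\<lambda>k. c k \<cdot>\<^sub>m F ^\<^sub>m k) K = 0\<^sub>m m m"
    and T: "T \<in> carrier_mat n n" "T * S = 1\<^sub>m n"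
    and X: "X \<in> carrier_mat n m"
  shows "A * X = C + X * F \<longleftrightarrow> X = T * R"
proof -
  have pA: "A ^\<^sub>m k \<in> carrier_mat n n" for k using A by (rule pow_carrier_mat)
  have pF: "F ^\<^sub>m k \<in> carrier_mat m m" for k using F by (rule pow_carrier_mat)
  have D: "D k \<in> carrier_mat n m" for k by (simp add: D_def)
  have S: "S \<in> carrier_mat n n" and R: "R \<in> carrier_mat n m" by (simp_all add: S_def R_def)
  note cl = A F C X T(1) pA pF D S R mult_carrier_mat[of _ n n _ m] mult_carrier_mat[of _ n m _ m]
    mult_carrier_mat[of _ n n _ n] mult_carrier_mat[of _ m m _ m]
  have comm: "A * S = S * A"
    unfolding S_def
    by (simp add: mat_sum_mult_left[OF A] mat_sum_mult_right[OF A] cl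
        mult_smult_distrib[OF A pA] mult_smult_assoc_mat[OF pA A] pow_mat_Suc_left[OF A])
  \<comment> \<open>Terms ending in a power of F drop out of a weighted sum: together they are Y
    times the annihilating polynomial at F.\<close>
  have YZ: "mat_sum n m (\<lambda>k. c k \<cdot>\<^sub>m (Y * F ^\<^sub>m k)) K = 0\<^sub>m n m"
    if Y: "Y \<in> carrier_mat n m" for Y
  proof -
    have "mat_sum n m (\<lambda>k. c k \<cdot>\<^sub>m (Y * F ^\<^sub>m k)) K = mat_sum n m (\<lambda>k. Y * (c k \<cdot>\<^sub>m F ^\<^sub>m k)) K"
      by (simp add: mult_smult_distrib[OF Y pF])
    also have "\<dots> = Y * mat_sum m m (\<lambda>k. c k \<cdot>\<^sub>m F ^\<^sub>m k) K"
      by (rule mat_sum_mult_left[OF Y, symmetric]) (simp add: pF)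
    finally show ?thesis using Y by (simp add: annihilates)
  qed
  have SY: "S * Y = mat_sum n m (\<lambda>k. c k \<cdot>\<^sub>m (A ^\<^sub>m k * Y)) K" if Y: "Y \<in> carrier_mat n m" for Y
    unfolding S_def by (simp add: mat_sum_mult_right[OF Y] pA mult_smult_assoc_mat[OF pA Y])
  have RS: "A * R = S * C + R * F"
  proof -
    \<comment> \<open>The vanishing sum is inserted to complete each A D(k) to the left side of the
      telescoping identity.\<close>
    have "A * R = A * R + mat_sum n m (\<lambda>k. c k \<cdot>\<^sub>m (C * F ^\<^sub>m k)) K"
      using cl by (simp add: YZ)
    also have "\<dots> = mat_sum n m (\<lambda>k. c k \<cdot>\<^sub>m (A * D k + C * F ^\<^sub>m k)) K"
      unfolding R_def
      by (simp add: mat_sum_mult_left[OF A] cl mat_sum_add[symmetric] mult_smult_distrib[OF A D]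
          add_smult_distrib_left_mat[of _ n m])
    also have "\<dots> = mat_sum n m (\<lambda>k. c k \<cdot>\<^sub>m (A ^\<^sub>m k * C + D k * F)) K"
      using sylvester_telescope_comm[OF A F C] by (simp add: D_def)
    also have "\<dots> = S * C + R * F"
      unfolding SY[OF C] unfolding R_def
      by (simp add: mat_sum_mult_right[OF F] cl mat_sum_add[symmetric] mult_smult_assoc_mat[OF D F]
          add_smult_distrib_left_mat[of _ n m])
    finally show ?thesis .
  qed
  have TS: "T * (S * Y) = Y" if Y: "Y \<in> carrier_mat n m" for Y
  proof -
    have "T * (S * Y) = (T * S) * Y"
      by (rule assoc_mult_mat[symmetric]) (rule T S Y)+
    then show ?thesis using T Y by simp
  qed
  show ?thesis
  proof
    assume eq: "A * X = C + X * F"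
    have "S * X = mat_sum n m (\<lambda>k. c k \<cdot>\<^sub>m (D k + X * F ^\<^sub>m k)) K"
      using sylvester_telescope_solution[OF A F C X eq] by (simp add: SY[OF X] D_def)
    also have "\<dots> = R + mat_sum n m (\<lambda>k. c k \<cdot>\<^sub>m (X * F ^\<^sub>m k)) K"
      unfolding R_def
      by (simp add: cl mat_sum_add[symmetric] add_smult_distrib_left_mat[of _ n m])
    also have "\<dots> = R" using R by (simp add: YZ X)
    finally show "X = T * R" using TS[OF X] by simp
  next
    assume eq: "X = T * R"
    \<comment> \<open>A left inverse of a square matrix is also a right inverse; this recovers S X =
      R from X = T R.\<close>
    have ST: "S * T = 1\<^sub>m n"
      using T S by (metis mat_mult_left_right_inverse)
    have SX: "S * X = R"
    proof -
      have "S * X = (S * T) * R"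
        unfolding eq by (rule assoc_mult_mat[symmetric]) (rule T S R)+
      then show ?thesis using R by (simp add: ST)
    qed
    \<comment> \<open>The equation is verified after multiplication by S, where \<open>comm\<close>
      and \<open>RS\<close> apply; T then removes S.\<close>
    have "S * (A * X) = A * (S * X)"
      by (simp add: assoc_mult_mat[of _ n n _ n _ m, symmetric] cl comm)
    also have "\<dots> = S * C + (S * X) * F" by (simp add: SX RS)
    also have "\<dots> = S * (C + X * F)"
      by (simp add: mult_add_distrib_mat[of _ n n _ m] assoc_mult_mat[of _ n n _ m _ m] cl)
    finally have eqS: "S * (A * X) = S * (C + X * F)" .
    have "A * X = T * (S * (A * X))"
      by (rule TS[symmetric]) (rule mult_carrier_mat[OF A X])
    also have "\<dots> = C + X * F"
      unfolding eqS by (rule TS) (intro add_carrier_mat mult_carrier_mat[OF X F])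
    finally show "A * X = C + X * F" .
  qed
qed

section \<open>The complex lifting\<close>

lemma bimat_carrierD:
  assumes "A \<in> bimat_carrier n m"
  shows "fst A \<in> carrier_mat n m" "snd A \<in> carrier_mat n m"
  using assms by (auto simp: bimat_carrier_def)

lemma bimat_lift_index:
  assumes "A \<in> bimat_carrier n m" "i < n + n" "j < m + m"
  shows "bimat_lift A $$ (i, j) =
    (if i < n then if j < m then fst A $$ (i, j) else cnj (snd A $$ (i, j - m))
     else if j < m then snd A $$ (i - n, j) else cnj (fst A $$ (i - n, j - m)))"
  using assms bimat_carrierD[OF assms(1)] by (auto simp: bimat_lift_def)

lemma bimat_add_carrier:
  assumes "A \<in> bimat_carrier n m" "B \<in> bimat_carrier n m"
  shows "A + B \<in> bimat_carrier n m"
  using assms by (auto simp: bimat_carrier_def)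

lemma bimat_smult_carrier:
  assumes "A \<in> bimat_carrier n m"
  shows "c \<cdot>\<^sub>b A \<in> bimat_carrier n m"
  using assms by (auto simp: bimat_carrier_def bimat_smult_def)

lemma bimat_id_carrier: "bimat_id n \<in> bimat_carrier n n"
  by (auto simp: bimat_carrier_def bimat_id_def)

lemma bimat_pow_carrier:
  assumes A: "A \<in> bimat_carrier n n"
  shows "A ^\<^sub>b k \<in> bimat_carrier n n"
proof (induction k)
  case 0
  have "dim_row (fst A) = n" using bimat_carrierD[OF A] by auto
  then show ?case by (simp add: bimat_id_carrier)
qed (simp add: bimat_mult_carrier[OF _ A])

lemma bimat_sum_carrier: "bimat_sum n m f K \<in> bimat_carrier n m"
  by (simp add: bimat_carrier_def bimat_sum_def)

lemma bimat_lift_add: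
  assumes "A \<in> bimat_carrier n m" "B \<in> bimat_carrier n m"
  shows "bimat_lift (A + B) = bimat_lift A + bimat_lift B"
proof (intro eq_matI)
  note L = assms[THEN bimat_lift_carrier] and D = assms[THEN bimat_carrierD(1)]
    assms[THEN bimat_carrierD(2)]
  note AB = bimat_add_carrier[OF assms]
  fix i j assume "i < dim_row (bimat_lift A + bimat_lift B)" "j < dim_col (bimat_lift A + bimat_lift B)"
  then have "i < n + n" "j < m + m" using L by auto
  then show "bimat_lift (A + B) $$ (i, j) = (bimat_lift A + bimat_lift B) $$ (i, j)"
    using L D
    by (simp add: bimat_lift_index[OF AB] bimat_lift_index[OF assms(1)] bimat_lift_index[OF assms(2)])
qed (use assms[THEN bimat_lift_carrier] bimat_lift_carrier[OF bimat_add_carrier[OF assms]] in auto)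

lemma bimat_lift_smult:
  assumes "A \<in> bimat_carrier n m"
  shows "bimat_lift (c \<cdot>\<^sub>b A) = complex_of_real c \<cdot>\<^sub>m bimat_lift A"
  using bimat_carrierD[OF assms]
  by (intro eq_matI) (auto simp: bimat_lift_def bimat_smult_def)

lemma bimat_lift_pow:
  assumes A: "A \<in> bimat_carrier n n"
  shows "bimat_lift (A ^\<^sub>b k) = bimat_lift A ^\<^sub>m k"
proof (induction k)
  case 0
  have "dim_row (fst A) = n" "dim_row (bimat_lift A) = n + n"
    using bimat_carrierD[OF A] bimat_lift_carrier[OF A] by auto
  then show ?case by (simp add: bimat_lift_id)
qed (simp add: bimat_lift_mult[OF bimat_pow_carrier[OF A] A])

lemma bimat_lift_sum:
  assumes f: "\<And>k. k \<in> K \<Longrightarrow> f k \<in> bimat_carrier n m"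
  shows "bimat_lift (bimat_sum n m f K) = mat_sum (n + n) (m + m) (\<lambda>k. bimat_lift (f k)) K"
proof (intro eq_matI)
  let ?L = "bimat_lift (bimat_sum n m f K)"
  have L: "?L \<in> carrier_mat (n + n) (m + m)"
    by (rule bimat_lift_carrier[OF bimat_sum_carrier])
  then show "dim_row ?L = dim_row (mat_sum (n + n) (m + m) (\<lambda>k. bimat_lift (f k)) K)"
    "dim_col ?L = dim_col (mat_sum (n + n) (m + m) (\<lambda>k. bimat_lift (f k)) K)"
    by auto
  fix i j assume "i < dim_row (mat_sum (n + n) (m + m) (\<lambda>k. bimat_lift (f k)) K)"
    "j < dim_col (mat_sum (n + n) (m + m) (\<lambda>k. bimat_lift (f k)) K)"
  then have ij: "i < n + n" "j < m + m" by auto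
  have "(\<Sum>k\<in>K. bimat_lift (f k) $$ (i, j)) = ?L $$ (i, j)"
    using ij unfolding bimat_lift_index[OF bimat_sum_carrier ij]
    by (cases "i < n"; cases "j < m") (simp_all add: bimat_lift_index[OF f] bimat_sum_def)
  then show "?L $$ (i, j) = mat_sum (n + n) (m + m) (\<lambda>k. bimat_lift (f k)) K $$ (i, j)"
    using ij by (simp add: mat_sum_def)
qed

text \<open>The lifting is additive, multiplicative and injective. Moving the difference to the
  other side leaves only sums and products to lift.\<close>

lemma bimat_sylvester_iff_lift:
  assumes A: "A \<in> bimat_carrier n n" and F: "F \<in> bimat_carrier p p"
    and C: "C \<in> bimat_carrier n p" and X: "X \<in> bimat_carrier n p"
  shows "A \<otimes>\<^sub>b X - X \<otimes>\<^sub>b F = C \<longleftrightarrow>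
    bimat_lift A * bimat_lift X = bimat_lift C + bimat_lift X * bimat_lift F"
proof -
  have AX: "A \<otimes>\<^sub>b X \<in> bimat_carrier n p" and XF: "X \<otimes>\<^sub>b F \<in> bimat_carrier n p"
    by (rule bimat_mult_carrier[OF A X], rule bimat_mult_carrier[OF X F])
  have mat: "Y - Z = W \<longleftrightarrow> Y = W + Z"
    if "Y \<in> carrier_mat n p" "Z \<in> carrier_mat n p" "W \<in> carrier_mat n p" for Y Z W :: "complex mat"
  proof
    assume "Y - Z = W"
    then show "Y = W + Z" using that by (auto intro!: eq_matI)
  next
    assume "Y = W + Z"
    then show "Y - Z = W" using that by (auto intro!: eq_matI)
  qed
  have "A \<otimes>\<^sub>b X - X \<otimes>\<^sub>b F = C \<longleftrightarrow> A \<otimes>\<^sub>b X = C + X \<otimes>\<^sub>b F"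
    using bimat_carrierD[OF AX] bimat_carrierD[OF XF] bimat_carrierD[OF C]
    by (simp add: prod_eq_iff mat)
  also have "\<dots> \<longleftrightarrow> bimat_lift (A \<otimes>\<^sub>b X) = bimat_lift (C + X \<otimes>\<^sub>b F)"
    using bimat_lift_inj[OF AX bimat_add_carrier[OF C XF]] by auto
  finally show ?thesis
    by (simp add: bimat_lift_add[OF C XF] bimat_lift_mult[OF A X] bimat_lift_mult[OF X F])
qed

text \<open>
  The first block column of \<open>bimat_lift (A \<otimes>\<^sub>b B)\<close> is \<open>bimat_lift A\<close> times the first block column
  of \<open>bimat_lift B\<close>, so the first block column of the inverse of the lifting is an inverse bimatrix.
\<close>

lemma bimat_inverts_exists:
  assumes A: "A \<in> bimat_carrier n n" and det: "det (bimat_lift A) \<noteq> 0"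
  shows "\<exists>B. bimat_inverts n A B"
proof -
  let ?a = "bimat_lift A"
  have a: "?a \<in> carrier_mat (n + n) (n + n)" by (rule bimat_lift_carrier[OF A])
  obtain A1 A2 where A12: "A = (A1, A2)" by (metis surj_pair)
  have c: "A1 \<in> carrier_mat n n" "A2 \<in> carrier_mat n n"
    "conj_mat A1 \<in> carrier_mat n n" "conj_mat A2 \<in> carrier_mat n n"
    using A A12 by (auto simp: bimat_carrier_def)
  \<comment> \<open>T is an inverse among all complex matrices; it is not claimed to be a
    lifting.\<close>
  obtain T where T: "T \<in> carrier_mat (n + n) (n + n)" and aT: "?a * T = 1\<^sub>m (n + n)"
    using det_non_zero_imp_unit[OF a det, of "()"] by (auto simp: Units_def ring_mat_def)
  obtain B1 Q B2 W where split: "split_block T n n = (B1, Q, B2, W)" by (metis prod_cases4)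
  from split_block[OF split] T
  have B: "B1 \<in> carrier_mat n n" "Q \<in> carrier_mat n n" "B2 \<in> carrier_mat n n" "W \<in> carrier_mat n n"
    and TB: "T = four_block_mat B1 Q B2 W"
    by auto
  have "four_block_mat (A1 * B1 + conj_mat A2 * B2) (A1 * Q + conj_mat A2 * W)
      (A2 * B1 + conj_mat A1 * B2) (A2 * Q + conj_mat A1 * W) = ?a * T"
    unfolding TB bimat_lift_def A12 fst_conv snd_conv using B c
    by (subst mult_four_block_mat[of _ n n _ n _ n _ _ n _ n]) auto
  then have eq: "four_block_mat (A1 * B1 + conj_mat A2 * B2) (A1 * Q + conj_mat A2 * W)
      (A2 * B1 + conj_mat A1 * B2) (A2 * Q + conj_mat A1 * W) $$ (i, j) = 1\<^sub>m (n + n) $$ (i, j)"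
    for i j
    by (simp add: aT)
  have AB: "A \<otimes>\<^sub>b (B1, B2) = bimat_id n"
  proof -
    have "A1 * B1 + conj_mat A2 * B2 = 1\<^sub>m n"
    proof (intro eq_matI)
      fix i j assume "i < dim_row (1\<^sub>m n)" "j < dim_col (1\<^sub>m n)"
      then show "(A1 * B1 + conj_mat A2 * B2) $$ (i, j) = 1\<^sub>m n $$ (i, j)"
        using eq[of i j] B c by simp
    qed (use B c in auto)
    moreover have "conj_mat A1 * B2 + A2 * B1 = 0\<^sub>m n n"
    proof (intro eq_matI)
      fix i j assume "i < dim_row (0\<^sub>m n n)" "j < dim_col (0\<^sub>m n n)"
      then show "(conj_mat A1 * B2 + A2 * B1) $$ (i, j) = 0\<^sub>m n n $$ (i, j)"
        using eq[of "n + i" j] B c by (simp add: add.commute)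
    qed (use B c in auto)
    ultimately show ?thesis by (simp add: A12 bimat_mult_def bimat_id_def)
  qed
  have Bc: "(B1, B2) \<in> bimat_carrier n n" using B by (simp add: bimat_carrier_def)
  have "?a * bimat_lift (B1, B2) = 1\<^sub>m (n + n)"
    using AB by (simp add: bimat_lift_id flip: bimat_lift_mult[OF A Bc])
  \<comment> \<open>A right inverse of a square matrix is a left inverse; injectivity of the lifting
    carries this back to bimatrices.\<close>
  then have "bimat_lift (B1, B2) * ?a = 1\<^sub>m (n + n)"
    by (rule mat_mult_left_right_inverse[OF a bimat_lift_carrier[OF Bc]])
  then have "bimat_lift ((B1, B2) \<otimes>\<^sub>b A) = bimat_lift (bimat_id n)"
    by (simp add: bimat_lift_mult[OF Bc A] bimat_lift_id)
  then have "(B1, B2) \<otimes>\<^sub>b A = bimat_id n"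
    by (rule bimat_lift_inj[OF bimat_mult_carrier[OF Bc A] bimat_id_carrier])
  then show ?thesis using AB Bc by (auto simp: bimat_inverts_def)
qed

section \<open>Common eigenvalues\<close>

text \<open>This is the matrix \<open>?J\<close> by which \<open>of_real_bimat_char_poly\<close>
  relates a lifting to its conjugate.\<close>

definition swap_mat :: "nat \<Rightarrow> complex mat" where
  "swap_mat n = four_block_mat (0\<^sub>m n n) (1\<^sub>m n) (1\<^sub>m n) (0\<^sub>m n n)"

lemma swap_mat_carrier [simp]: "swap_mat n \<in> carrier_mat (n + n) (n + n)"
  by (simp add: swap_mat_def)

lemma swap_mat_mult_four_block:
  assumes "P \<in> carrier_mat n m" "Q \<in> carrier_mat n m" "R \<in> carrier_mat n m" "W \<in> carrier_mat n m"
  shows "swap_mat n * four_block_mat P Q R W = four_block_mat R W P Q"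
    and "four_block_mat P Q R W * swap_mat m = four_block_mat Q P W R"
  using assms unfolding swap_mat_def
  by (auto simp: mult_four_block_mat[of _ n n _ n _ n _ _ m _ m] mult_four_block_mat[of _ n m _ m _ n _ _ m _ m])

text \<open>Conjugating a lifting exchanges the two diagonal blocks and the two off-diagonal blocks;
  swapping block rows and columns undoes this. One swap on each side of the equation covers the
  rectangular case.\<close>

lemma swap_mat_conj_lift:
  assumes A: "A \<in> bimat_carrier n m"
  shows "swap_mat n * conj_mat (bimat_lift A) = bimat_lift A * swap_mat m"
proof -
  obtain A1 A2 where A12: "A = (A1, A2)" by (metis surj_pair)
  have c: "A1 \<in> carrier_mat n m" "A2 \<in> carrier_mat n m"
    "conj_mat A1 \<in> carrier_mat n m" "conj_mat A2 \<in> carrier_mat n m"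
    using A A12 by (auto simp: bimat_carrier_def)
  show ?thesis
    using c by (simp add: A12 bimat_lift_def map_four_block_mat[of _ n m _ m _ n] conj_mat_conj_mat
        swap_mat_mult_four_block)
qed

text \<open>Adding the swapped conjugate makes the diagonal blocks conjugate to each other, and
  likewise the off-diagonal ones, which is the pattern of a lifting.\<close>

lemma bimat_lift_symmetrize:
  assumes M: "M \<in> carrier_mat (n + n) (m + m)"
  shows "\<exists>K \<in> bimat_carrier n m. bimat_lift K = M + swap_mat n * conj_mat M * swap_mat m"
proof -
  obtain P Q R W where split: "split_block M n m = (P, Q, R, W)" by (metis prod_cases4)
  from split_block[OF split] M
  have B: "P \<in> carrier_mat n m" "Q \<in> carrier_mat n m" "R \<in> carrier_mat n m" "W \<in> carrier_mat n m"
    and MB: "M = four_block_mat P Q R W"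
    by auto
  have cB: "conj_mat P \<in> carrier_mat n m" "conj_mat Q \<in> carrier_mat n m"
    "conj_mat R \<in> carrier_mat n m" "conj_mat W \<in> carrier_mat n m"
    using B by auto
  have "swap_mat n * conj_mat M * swap_mat m
      = four_block_mat (conj_mat W) (conj_mat R) (conj_mat Q) (conj_mat P)"
    using B cB by (simp add: MB map_four_block_mat[of _ n m _ m _ n] swap_mat_mult_four_block)
  then have "M + swap_mat n * conj_mat M * swap_mat m =
      bimat_lift (P + conj_mat W, R + conj_mat Q)"
    using B cB
    by (simp add: MB bimat_lift_def add_four_block_mat[of _ n m _ m _ n] conj_mat_add[of _ n m]
        conj_mat_conj_mat comm_add_mat[of _ n m])
  then show ?thesis
    using B by (intro bexI[of _ "(P + conj_mat W, R + conj_mat Q)"]) (auto simp: bimat_carrier_def)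
qed

text \<open>
  With \<open>J = swap_mat\<close>, the liftings are the matrices fixed by \<open>M \<mapsto> J M\<^sup># J\<close>, and this
  conjugate-linear involution preserves the solutions of \<open>a M = M f\<close>. If \<open>M\<close> is
  nonzero, then \<open>M\<close> or \<open>\<i> M\<close> has a nonzero symmetrization \<open>M + J M\<^sup># J\<close>.
\<close>

lemma bimat_intertwiner_exists:
  assumes A: "A \<in> bimat_carrier n n" and F: "F \<in> bimat_carrier m m"
    and M: "M \<in> carrier_mat (n + n) (m + m)" "M \<noteq> 0\<^sub>m (n + n) (m + m)"
    and eq: "bimat_lift A * M = M * bimat_lift F"
  shows "\<exists>K \<in> bimat_carrier n m. bimat_lift K \<noteq> 0\<^sub>m (n + n) (m + m) \<and>
    bimat_lift A * bimat_lift K = bimat_lift K * bimat_lift F"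
proof -
  let ?a = "bimat_lift A" and ?f = "bimat_lift F"
  let ?N = "n + n" and ?M = "m + m"
  define S where "S M = swap_mat n * conj_mat M * swap_mat m" for M
  have a: "?a \<in> carrier_mat ?N ?N" "conj_mat ?a \<in> carrier_mat ?N ?N"
    and f: "?f \<in> carrier_mat ?M ?M" "conj_mat ?f \<in> carrier_mat ?M ?M"
    using bimat_lift_carrier[OF A] bimat_lift_carrier[OF F] by auto
  have cM: "conj_mat X \<in> carrier_mat ?N ?M" if "X \<in> carrier_mat ?N ?M" for X
    using that by auto
  note cl = a f cM mult_carrier_mat[of _ ?N ?N _ ?M] mult_carrier_mat[of _ ?N ?M _ ?M]
    mult_carrier_mat[of _ ?N ?N _ ?N] mult_carrier_mat[of _ ?M ?M _ ?M]
  have Sc: "S X \<in> carrier_mat ?N ?M" if "X \<in> carrier_mat ?N ?M" for X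
    using that by (simp add: S_def cl)
  \<comment> \<open>Conjugating the equation for X and moving the swaps through both liftings shows
    that \<open>S X\<close> solves it too.\<close>
  have sym: "?a * (X + S X) = (X + S X) * ?f"
    if X: "X \<in> carrier_mat ?N ?M" and eqX: "?a * X = X * ?f" for X
  proof -
    have "?a * S X = (?a * swap_mat n) * conj_mat X * swap_mat m"
      unfolding S_def using X
      by (simp add: assoc_mult_mat[of _ ?N ?N _ ?N _ ?M] assoc_mult_mat[of _ ?N ?N _ ?M _ ?M] cl)
    also have "\<dots> = swap_mat n * (conj_mat ?a * conj_mat X) * swap_mat m"
      unfolding swap_mat_conj_lift[OF A, symmetric] using X
      by (simp add: assoc_mult_mat[of _ ?N ?N _ ?N _ ?M] cl)
    also have "conj_mat ?a * conj_mat X = conj_mat X * conj_mat ?f"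
      using X by (simp add: conj_mat_mult[OF a(1) X, symmetric] conj_mat_mult[OF X f(1), symmetric] eqX)
    also have "swap_mat n * (conj_mat X * conj_mat ?f) * swap_mat m
        = swap_mat n * conj_mat X * (conj_mat ?f * swap_mat m)"
      using X by (simp add: assoc_mult_mat[of _ ?N ?N _ ?M _ ?M] assoc_mult_mat[of _ ?N ?M _ ?M _ ?M] cl)
    \<comment> \<open>The commutation rule is turned around by multiplying with the swap on both
      sides, since the swap squares to the identity.\<close>
    also have "conj_mat ?f * swap_mat m = swap_mat m * ?f"
    proof -
      have "swap_mat m * (swap_mat m * conj_mat ?f) * swap_mat m
          = swap_mat m * (?f * swap_mat m) * swap_mat m"
        by (simp add: swap_mat_conj_lift[OF F])
      moreover have "swap_mat m * swap_mat m = 1\<^sub>m ?M"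
        unfolding swap_mat_def[of m]
        by (subst mult_four_block_mat[of _ m m _ m _ m _ _ m _ m]) (auto intro!: eq_matI)
      ultimately show ?thesis
        using f by (simp add: assoc_mult_mat[of _ ?M ?M _ ?M _ ?M, symmetric] cl)
          (simp add: assoc_mult_mat[of _ ?M ?M _ ?M _ ?M] right_mult_one_mat[OF f(1)] cl)
    qed
    also have "swap_mat n * conj_mat X * (swap_mat m * ?f) = S X * ?f"
      unfolding S_def using X by (simp add: assoc_mult_mat[of _ ?N ?M _ ?M _ ?M] cl)
    finally have "?a * S X = S X * ?f" .
    then show ?thesis
      using X by (simp add: mult_add_distrib_mat[of _ ?N ?N _ ?M] add_mult_distrib_mat[of _ ?N ?M _ _ ?M]
          eqX cl Sc)
  qed
  let ?iM = "\<i> \<cdot>\<^sub>m M"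
  have iM: "?iM \<in> carrier_mat ?N ?M" "?a * ?iM = ?iM * ?f"
    using M a f eq by (simp_all add: mult_smult_distrib[OF a(1) M(1)] mult_smult_assoc_mat[OF M(1) f(1)])
  have SiM: "S ?iM = (- \<i>) \<cdot>\<^sub>m S M"
  proof -
    have "conj_mat ?iM = (- \<i>) \<cdot>\<^sub>m conj_mat M" by (intro eq_matI) auto
    then show ?thesis
      unfolding S_def
      using mult_smult_distrib[OF swap_mat_carrier cM[OF M(1)], of "- \<i>"]
        mult_smult_assoc_mat[OF mult_carrier_mat[OF swap_mat_carrier cM[OF M(1)]] swap_mat_carrier, of "- \<i>"]
      by simp
  qed
  \<comment> \<open>If both symmetrizations vanished, the first would give S M = - M and the second,
    by \<open>SiM\<close>, S M = M; hence M = 0.\<close>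
  have "M + S M \<noteq> 0\<^sub>m ?N ?M \<or> ?iM + S ?iM \<noteq> 0\<^sub>m ?N ?M"
  proof (rule ccontr)
    assume "\<not> ?thesis"
    then have z: "M + S M = 0\<^sub>m ?N ?M" "?iM + S ?iM = 0\<^sub>m ?N ?M" by auto
    have "M $$ (i, j) = 0" if ij: "i < ?N" "j < ?M" for i j
    proof -
      have "M $$ (i, j) + S M $$ (i, j) = 0"
        using arg_cong[OF z(1), of "\<lambda>X. X $$ (i, j)"] ij M(1) Sc[OF M(1)] by simp
      moreover have "\<i> * M $$ (i, j) - \<i> * S M $$ (i, j) = 0"
        using arg_cong[OF z(2), of "\<lambda>X. X $$ (i, j)"] ij M(1) Sc[OF M(1)] by (simp add: SiM)
      ultimately show ?thesis
        by (simp add: add_eq_0_iff2)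
    qed
    then have "M = 0\<^sub>m ?N ?M" using M(1) by (intro eq_matI) auto
    then show False using M(2) by simp
  qed
  then obtain X where X: "X \<in> carrier_mat ?N ?M" "?a * X = X * ?f" "X + S X \<noteq> 0\<^sub>m ?N ?M"
    using M(1) eq iM by blast
  obtain K where K: "K \<in> bimat_carrier n m" "bimat_lift K = X + S X"
    using bimat_lift_symmetrize[OF X(1)] by (auto simp: S_def)
  show ?thesis
    by (rule bexI[OF _ K(1)]) (simp add: K(2) X(3) sym[OF X(1,2)])
qed

text \<open>For A u = e u and v^T F = e v^T, both products scale the rank-one matrix u v^T by
  e.\<close>

lemma common_eigenvalue_intertwiner:
  fixes A F :: "'a :: field mat"
  assumes A: "A \<in> carrier_mat n n" and F: "F \<in> carrier_mat m m"
    and e: "e \<in> spectrum A" "e \<in> spectrum F"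
  shows "\<exists>M \<in> carrier_mat n m. M \<noteq> 0\<^sub>m n m \<and> A * M = M * F"
proof -
  have "eigenvalue A e" using e(1) by (simp add: spectrum_def)
  then obtain u where u: "u \<in> carrier_vec n" "u \<noteq> 0\<^sub>v n" "A *\<^sub>v u = e \<cdot>\<^sub>v u"
    using A by (auto simp: eigenvalue_def eigenvector_def)
  have F': "transpose_mat F \<in> carrier_mat m m" using F by simp
  \<comment> \<open>A matrix and its transpose share the characteristic polynomial, so e also has a
    left eigenvector of F.\<close>
  have "eigenvalue (transpose_mat F) e"
    using e(2) by (simp add: spectrum_def eigenvalue_root_char_poly[OF F] eigenvalue_root_char_poly[OF F']
        char_poly_transpose_mat[OF F])
  then obtain v where v: "v \<in> carrier_vec m" "v \<noteq> 0\<^sub>v m" "transpose_mat F *\<^sub>v v = e \<cdot>\<^sub>v v"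
    using F by (auto simp: eigenvalue_def eigenvector_def)
  define M where "M = mat n m (\<lambda>(i, j). u $ i * v $ j)"
  have M: "M \<in> carrier_mat n m" by (simp add: M_def)
  have "A * M = e \<cdot>\<^sub>m M"
  proof (intro eq_matI)
    fix i j assume "i < dim_row (e \<cdot>\<^sub>m M)" "j < dim_col (e \<cdot>\<^sub>m M)"
    then have ij: "i < n" "j < m" using M by auto
    have "(A * M) $$ (i, j) = (A *\<^sub>v u) $ i * v $ j"
      using A u(1) ij by (simp add: M_def scalar_prod_def sum_distrib_right mult.assoc)
    then show "(A * M) $$ (i, j) = (e \<cdot>\<^sub>m M) $$ (i, j)"
      using u(1) ij unfolding u(3) by (simp add: M_def mult.assoc)
  qed (use A M in auto)
  moreover have "M * F = e \<cdot>\<^sub>m M"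
  proof (intro eq_matI)
    fix i j assume "i < dim_row (e \<cdot>\<^sub>m M)" "j < dim_col (e \<cdot>\<^sub>m M)"
    then have ij: "i < n" "j < m" using M by auto
    have "(M * F) $$ (i, j) = u $ i * (transpose_mat F *\<^sub>v v) $ j"
      using F v(1) ij by (simp add: M_def scalar_prod_def sum_distrib_left ac_simps)
    then show "(M * F) $$ (i, j) = (e \<cdot>\<^sub>m M) $$ (i, j)"
      using v(1) ij unfolding v(3) by (simp add: M_def ac_simps)
  qed (use F M in auto)
  moreover have "M \<noteq> 0\<^sub>m n m"
  proof
    assume z: "M = 0\<^sub>m n m"
    obtain i where i: "i < n" "u $ i \<noteq> 0" using u(1,2) by (metis carrier_vecD eq_vecI index_zero_vec)
    obtain j where j: "j < m" "v $ j \<noteq> 0" using v(1,2) by (metis carrier_vecD eq_vecI index_zero_vec)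
    show False
      using arg_cong[OF z, of "\<lambda>X. X $$ (i, j)"] i j by (simp add: M_def)
  qed
  ultimately show ?thesis using M by auto
qed

section \<open>Unique solvability of the bimatrix equation and its closed-form solution\<close>

theorem proposition1:
  fixes n p :: nat and A F C :: bimatrix
  assumes A: "A \<in> bimat_carrier n n"
    and F: "F \<in> bimat_carrier p p"
    and C: "C \<in> bimat_carrier n p"
  shows "((\<exists>!X. X \<in> bimat_carrier n p \<and> A \<otimes>\<^sub>b X - X \<otimes>\<^sub>b F = C) \<longleftrightarrow>
            bimat_spectrum A \<inter> bimat_spectrum F = {}) \<and>
         (bimat_spectrum A \<inter> bimat_spectrum F = {} \<longrightarrow>
           (let \<beta> = coeff (bimat_char_poly F);
                D = (\<lambda>k. bimat_sum n p (\<lambda>i. A ^\<^sub>b i \<otimes>\<^sub>b C \<otimes>\<^sub>b F ^\<^sub>b (k - 1 - i)) {0..k - 1});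
                S = bimat_sum n n (\<lambda>k. \<beta> k \<cdot>\<^sub>b A ^\<^sub>b k) {0..2 * p}
            in bimat_invertible S \<and>
               (\<forall>X. X \<in> bimat_carrier n p \<and> A \<otimes>\<^sub>b X - X \<otimes>\<^sub>b F = C \<longleftrightarrow>
                    X = bimat_inv S \<otimes>\<^sub>b bimat_sum n p (\<lambda>k. \<beta> k \<cdot>\<^sub>b D k) {1..2 * p})))"
proof -
  let ?sol = "\<lambda>X. X \<in> bimat_carrier n p \<and> A \<otimes>\<^sub>b X - X \<otimes>\<^sub>b F = C"
  let ?disj = "bimat_spectrum A \<inter> bimat_spectrum F = {}"
  let ?a = "bimat_lift A" and ?f = "bimat_lift F" and ?c = "bimat_lift C"
  let ?N = "n + n" and ?P = "p + p"
  define \<beta> where "\<beta> = coeff (bimat_char_poly F)"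
  define D where "D k = bimat_sum n p (\<lambda>i. A ^\<^sub>b i \<otimes>\<^sub>b C \<otimes>\<^sub>b F ^\<^sub>b (k - 1 - i)) {0..k - 1}" for k
  define S where "S = bimat_sum n n (\<lambda>k. \<beta> k \<cdot>\<^sub>b A ^\<^sub>b k) {0..2 * p}"
  define R where "R = bimat_sum n p (\<lambda>k. \<beta> k \<cdot>\<^sub>b D k) {1..2 * p}"
  define q where "q = char_poly ?f"
  define E where "E k = mat_sum ?N ?P (\<lambda>i. ?a ^\<^sub>m i * ?c * ?f ^\<^sub>m (k - 1 - i)) {..<k}" for k
  have a: "?a \<in> carrier_mat ?N ?N" and f: "?f \<in> carrier_mat ?P ?P" and c: "?c \<in> carrier_mat ?N ?P"
    by (rule bimat_lift_carrier[OF A], rule bimat_lift_carrier[OF F], rule bimat_lift_carrier[OF C])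
  have Ak: "A ^\<^sub>b k \<in> bimat_carrier n n" and Fk: "F ^\<^sub>b k \<in> bimat_carrier p p" for k
    by (rule bimat_pow_carrier[OF A], rule bimat_pow_carrier[OF F])
  have \<beta>: "complex_of_real (\<beta> k) = coeff q k" for k
    unfolding q_def \<beta>_def of_real_bimat_char_poly[OF F, symmetric] by (simp add: coeff_map_poly)
  have deg: "degree q = 2 * p"
    using degree_monic_char_poly[OF f] by (simp add: q_def)
  have Dc: "D k \<in> bimat_carrier n p" for k by (simp add: D_def bimat_sum_carrier)
  have Sc: "S \<in> bimat_carrier n n" and Rc: "R \<in> bimat_carrier n p"
    by (simp_all add: S_def R_def bimat_sum_carrier)
  \<comment> \<open>For k = 0 the range \<open>{0..k - 1}\<close> is \<open>{0}\<close>, so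
    \<open>D 0\<close> is not the empty sum \<open>E 0\<close>; hence the restriction on k.\<close>
  have lift_D: "bimat_lift (D k) = E k" if "k \<ge> 1" for k
  proof -
    have "{0..k - 1} = {..<k}" using that by auto
    moreover have "bimat_lift (A ^\<^sub>b i \<otimes>\<^sub>b C \<otimes>\<^sub>b F ^\<^sub>b j) = ?a ^\<^sub>m i * ?c * ?f ^\<^sub>m j" for i j
      by (simp add: bimat_lift_mult[OF bimat_mult_carrier[OF Ak C] Fk] bimat_lift_mult[OF Ak C]
          bimat_lift_pow[OF A] bimat_lift_pow[OF F])
    ultimately show ?thesis
      unfolding D_def E_def
      by (simp add: bimat_lift_sum bimat_mult_carrier[OF bimat_mult_carrier[OF Ak C] Fk])
  qed
  have lift_S: "bimat_lift S = mat_sum ?N ?N (\<lambda>k. coeff q k \<cdot>\<^sub>m ?a ^\<^sub>m k) {..2 * p}"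
    unfolding S_def
    by (simp add: bimat_lift_sum bimat_smult_carrier[OF Ak] bimat_lift_smult[OF Ak] \<beta>
        bimat_lift_pow[OF A] atLeast0AtMost)
  have lift_R: "bimat_lift R = mat_sum ?N ?P (\<lambda>k. coeff q k \<cdot>\<^sub>m E k) {..2 * p}"
  proof -
    have "bimat_lift R = mat_sum ?N ?P (\<lambda>k. coeff q k \<cdot>\<^sub>m bimat_lift (D k)) {1..2 * p}"
      unfolding R_def
      by (simp add: bimat_lift_sum bimat_smult_carrier[OF Dc] bimat_lift_smult[OF Dc] \<beta>)
    also have "\<dots> = mat_sum ?N ?P (\<lambda>k. coeff q k \<cdot>\<^sub>m E k) {1..2 * p}"
      by (rule mat_sum_cong) (simp add: lift_D)
    \<comment> \<open>A zero summand at k = 0 gives R the index set of S, as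
      \<open>sylvester_mat_solution\<close> requires.\<close>
    also have "\<dots> = mat_sum ?N ?P (\<lambda>k. coeff q k \<cdot>\<^sub>m E k) {..2 * p}"
    proof (rule mat_sum_mono_neutral)
      fix k assume "k \<in> {..2 * p} - {1..2 * p}"
      then have "k = 0" by auto
      then show "coeff q k \<cdot>\<^sub>m E k = 0\<^sub>m ?N ?P"
        by (intro eq_matI) (simp_all add: E_def mat_sum_empty)
    qed auto
    finally show ?thesis .
  qed
  have solution: "bimat_invertible S \<and> (\<forall>X. ?sol X \<longleftrightarrow> X = bimat_inv S \<otimes>\<^sub>b R)" if disj: ?disj
  proof -
    \<comment> \<open>The lifting of S is the characteristic polynomial of \<open>?f\<close>
      evaluated at \<open>?a\<close>.\<close>
    have "det (bimat_lift S) \<noteq> 0"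
      using det_mat_poly_char_poly_nonzero[OF a f] disj mat_poly_upto[OF a, of q "2 * p"]
      by (simp add: bimat_spectrum_def lift_S q_def[symmetric] deg)
    then obtain T where T: "bimat_inverts n S T"
      using bimat_inverts_exists[OF Sc] by blast
    then have Tc: "T \<in> bimat_carrier n n" and TS: "T \<otimes>\<^sub>b S = bimat_id n"
      by (auto simp: bimat_inverts_def)
    have inv: "bimat_inv S = T" by (rule bimat_inv_eq[OF Sc T])
    have lift_T: "bimat_lift T \<in> carrier_mat ?N ?N" "bimat_lift T * bimat_lift S = 1\<^sub>m ?N"
      using bimat_lift_carrier[OF Tc] TS by (simp_all add: bimat_lift_id flip: bimat_lift_mult[OF Tc Sc])
    have zero: "mat_sum ?P ?P (\<lambda>k. coeff q k \<cdot>\<^sub>m ?f ^\<^sub>m k) {..2 * p} = 0\<^sub>m ?P ?P"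
      using cayley_hamilton[OF f] mat_poly_upto[OF f, of q "2 * p"] by (simp add: q_def[symmetric] deg)
    have TR: "T \<otimes>\<^sub>b R \<in> bimat_carrier n p" by (rule bimat_mult_carrier[OF Tc Rc])
    have "A \<otimes>\<^sub>b X - X \<otimes>\<^sub>b F = C \<longleftrightarrow> X = T \<otimes>\<^sub>b R" if X: "X \<in> bimat_carrier n p" for X
    proof -
      have "A \<otimes>\<^sub>b X - X \<otimes>\<^sub>b F = C \<longleftrightarrow> bimat_lift X = bimat_lift T * bimat_lift R"
        unfolding bimat_sylvester_iff_lift[OF A F C X] lift_R E_def
        by (rule sylvester_mat_solution[OF a f c zero lift_T[unfolded lift_S] bimat_lift_carrier[OF X]])
      also have "\<dots> \<longleftrightarrow> X = T \<otimes>\<^sub>b R"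
        unfolding bimat_lift_mult[OF Tc Rc, symmetric] using bimat_lift_inj[OF X TR] by auto
      finally show ?thesis .
    qed
    then have "?sol X \<longleftrightarrow> X = bimat_inv S \<otimes>\<^sub>b R" for X
      unfolding inv using TR by blast
    moreover have "dim_row (fst S) = n" using bimat_carrierD[OF Sc] by auto
    ultimately show ?thesis
      using T unfolding bimat_invertible_def by blast
  qed
  have "\<not> (\<exists>!X. ?sol X)" if not_disj: "\<not> ?disj"
  proof
    assume "\<exists>!X. ?sol X"
    then obtain X where X: "?sol X" and unique: "\<And>Y. ?sol Y \<Longrightarrow> Y = X" by blast
    obtain e where e: "e \<in> spectrum ?a" "e \<in> spectrum ?f"
      using not_disj by (auto simp: bimat_spectrum_def)
    obtain M where M: "M \<in> carrier_mat ?N ?P" "M \<noteq> 0\<^sub>m ?N ?P" "?a * M = M * ?f"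
      using common_eigenvalue_intertwiner[OF a f e] by blast
    obtain K where K: "K \<in> bimat_carrier n p" "bimat_lift K \<noteq> 0\<^sub>m ?N ?P"
      "?a * bimat_lift K = bimat_lift K * ?f"
      using bimat_intertwiner_exists[OF A F M] by blast
    have Xc: "X \<in> bimat_carrier n p" using X by blast
    have x: "bimat_lift X \<in> carrier_mat ?N ?P" and k: "bimat_lift K \<in> carrier_mat ?N ?P"
      by (rule bimat_lift_carrier[OF Xc], rule bimat_lift_carrier[OF K(1)])
    \<comment> \<open>K solves the homogeneous equation, so X + K will be a second solution.\<close>
    have XK: "X + K \<in> bimat_carrier n p" by (rule bimat_add_carrier[OF Xc K(1)])
    have "?a * bimat_lift X = ?c + bimat_lift X * ?f"
      using X bimat_sylvester_iff_lift[OF A F C Xc] by blast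
    then have "?a * (bimat_lift X + bimat_lift K) = ?c + (bimat_lift X + bimat_lift K) * ?f"
      by (simp add: mult_add_distrib_mat[OF a x k] add_mult_distrib_mat[OF x k f] K(3)
          assoc_add_mat[OF c mult_carrier_mat[OF x f] mult_carrier_mat[OF k f]])
    then have "?sol (X + K)"
      using XK bimat_sylvester_iff_lift[OF A F C XK] by (simp add: bimat_lift_add[OF Xc K(1)])
    then have "X + K = X" by (rule unique)
    then have "bimat_lift X + bimat_lift K = bimat_lift X"
      by (metis bimat_lift_add[OF Xc K(1)])
    then have "bimat_lift X $$ (i, j) + bimat_lift K $$ (i, j) = bimat_lift X $$ (i, j)"
      if "i < ?N" "j < ?P" for i j
      using that x k by (metis carrier_matD index_add_mat(1))
    then have "bimat_lift K = 0\<^sub>m ?N ?P" using k by (intro eq_matI) auto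
    then show False using K(2) by simp
  qed
  moreover have "\<exists>!X. ?sol X" if ?disj
  proof -
    have iff: "?sol X \<longleftrightarrow> X = bimat_inv S \<otimes>\<^sub>b R" for X
      using solution[OF that] by (rule conjunct2[THEN spec])
    show ?thesis
      unfolding iff by (rule ex1_eq)
  qed
  ultimately have "(\<exists>!X. ?sol X) \<longleftrightarrow> ?disj"
    by argo
  moreover have "?disj \<longrightarrow> bimat_invertible S \<and> (\<forall>X. ?sol X \<longleftrightarrow> X = bimat_inv S \<otimes>\<^sub>b R)"
    using solution by (rule impI)
  ultimately show ?thesis
    unfolding Let_def S_def R_def D_def \<beta>_def by (rule conjI)
qed

end
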